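(* In the Bayesian $k$-armed bandit problem described in the context, suppose every $P_\mu\in\mathcal{F}$ is $1$-subgaussian (i.e. for $Z\sim P_\mu$ and all real $s$, $\mathbb{E}[\exp(s(Z-\mu))]\le\exp(s^2/2)$), and that there is $D_0$ with $g(x)\le D_0$ for all $x\in[0,1]$. Then the Bayesian regret of the UCB algorithm satisfies $$BR_{T,k}(\mathrm{UCB})\le k\bigl[1+D_0+D_0(10+18\log f(T))(2+2\log k+\log T)\bigr],$$ where $f(t)=1+t\log^2 t$.
   Context: Bayesian $k$-armed bandit: horizon $T$, arms $[k]$. $\mathcal{F}=\{P_\mu:\mu\in[0,1]\}$ reward distributions, $P_\mu$ with mean $\mu$; prior $\Gamma$ on $[0,1]$ with density $g$; means $\mu_1,\dots,\mu_k$ i.i.d. $\sim\Gamma$; pulling arm $i$ at time $t$ gives $Y_{it}\sim P_{\mu_i}$ independently, only the pulled arm's reward observed. For a policy $\pi$, $R_T(\pi\mid\bm\mu)=T\max_i\mu_i-\sum_{t=1}^T\mathbb{E}[\mu_{a_t}\mid\pi]$ and $BR_{T,k}(\pi)=\mathbb{E}[R_T(\pi\mid\bm\mu)]$ (expectation also over the prior). $N_i(t)=\sum_{s\le t}\mathbf 1(a_s=i)$, $\hat\mu_i(t)=\sum_{s\le t}Y_{is}\mathbf 1(a_s=i)/N_i(t)$ (set to $1$ if $N_i(t)=0$), $f(t)=1+t\log^2(t)$, $\log$ natural. UCB algorithm: for $t\le k$ pull arm $t$; for $t\ge k+1$ pull $\arg\max_i\bigl[\hat\mu_i(t-1)+\sqrt{2\log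 f(t)/N_i(t-1)}\bigr]$. *)

theory Defs
  imports "HOL-Probability.Probability"
begin

text \<open>Arms are 1..k, times are 1..T. A reward table Y assigns to arm i and time t the
reward Y i t that would be observed if arm i were pulled at time t. A history is the list
of arms pulled at times 1, 2, ... (entry s-1 is the arm pulled at time s).\<close>

definition f_ucb :: "real \<Rightarrow> real" where
  "f_ucb t = 1 + t * (ln t)^2"

definition pulls :: "nat list \<Rightarrow> nat \<Rightarrow> nat" where
  "pulls hs i = length (filter (\<lambda>a. a = i) hs)"

definition emp_mean :: "(nat \<Rightarrow> nat \<Rightarrow> real) \<Rightarrow> nat list \<Rightarrow> nat \<Rightarrow> real" where
  "emp_mean Y hs i =
     (if pulls hs i = 0 then 1
      else (\<Sum>s<length hs. if hs ! s = i then Y i (Suc s) else 0) / real (pulls hs i))"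

definition ucb_index :: "(nat \<Rightarrow> nat \<Rightarrow> real) \<Rightarrow> nat list \<Rightarrow> nat \<Rightarrow> nat \<Rightarrow> real" where
  "ucb_index Y hs t i = emp_mean Y hs i + sqrt (2 * ln (f_ucb (real t)) / real (pulls hs i))"

definition next_arm :: "nat \<Rightarrow> (nat \<Rightarrow> nat \<Rightarrow> real) \<Rightarrow> nat list \<Rightarrow> nat \<Rightarrow> nat" where
  "next_arm k Y hs t =
     (if t \<le> k then t
      else (LEAST i. i \<in> {1..k} \<and> (\<forall>j\<in>{1..k}. ucb_index Y hs t j \<le> ucb_index Y hs t i)))"

primrec ucb_hist :: "nat \<Rightarrow> (nat \<Rightarrow> nat \<Rightarrow> real) \<Rightarrow> nat \<Rightarrow> nat list" where
  "ucb_hist k Y 0 = []"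
| "ucb_hist k Y (Suc t) = ucb_hist k Y t @ [next_arm k Y (ucb_hist k Y t) (Suc t)]"

definition ucb_action :: "nat \<Rightarrow> (nat \<Rightarrow> nat \<Rightarrow> real) \<Rightarrow> nat \<Rightarrow> nat" where
  "ucb_action k Y t = ucb_hist k Y t ! (t - 1)"

definition reward_space :: "(real \<Rightarrow> real measure) \<Rightarrow> nat \<Rightarrow> nat \<Rightarrow> (nat \<Rightarrow> real)
    \<Rightarrow> (nat \<times> nat \<Rightarrow> real) measure" where
  "reward_space P k T mu = PiM ({1..k} \<times> {1..T}) (\<lambda>(i, t). P (mu i))"

definition ucb_regret :: "(real \<Rightarrow> real measure) \<Rightarrow> nat \<Rightarrow> nat \<Rightarrow> (nat \<Rightarrow> real) \<Rightarrow> real" where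
  "ucb_regret P k T mu =
     real T * Max (mu ` {1..k})
     - (\<Sum>t\<in>{1..T}. \<integral>\<omega>. mu (ucb_action k (\<lambda>i s. \<omega> (i, s)) t) \<partial>(reward_space P k T mu))"

definition ucb_bayes_regret :: "(real \<Rightarrow> real measure) \<Rightarrow> real measure \<Rightarrow> nat \<Rightarrow> nat \<Rightarrow> real" where
  "ucb_bayes_regret P Pr k T = (\<integral>mu. ucb_regret P k T mu \<partial>(PiM {1..k} (\<lambda>_. Pr)))"

end

theory Submission
  imports Defs "HOL-Analysis.Harmonic_Numbers"
begin

text \<open>For a suboptimal arm \<open>i\<close> with gap \<open>D\<close>, Chernoff bounds for the rewards of \<open>i\<close> and of the best
arm give at most \<open>1 + C / D\<^sup>2\<close> expected pulls with \<open>C = 52 + 32 ln f(T)\<close>, so the arm contributes at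
most \<open>1 + min (T D) (C / D)\<close> to the regret. Given the other means, the distribution of the gap of
arm \<open>i\<close> has density at most \<open>D0\<close> away from \<open>0\<close>. Splitting at \<open>D = 1 / sqrt T\<close>, the contribution of
\<open>i\<close> to the Bayesian regret is at most \<open>1 + D0 (1 / 2 + (C / 2) ln T)\<close>, which is below the claimed
bound per arm: its larger logarithmic factor absorbs the larger constant in \<open>C\<close>.\<close>

subsection \<open>Pathwise analysis of UCB\<close>

lemma length_ucb_hist [simp]: "length (ucb_hist k Y n) = n"
  by (induction n) auto

declare ucb_hist.simps(2) [simp del]

lemma ucb_action_eq: "1 \<le> t \<Longrightarrow> ucb_action k Y t = next_arm k Y (ucb_hist k Y (t - 1)) t"
  by (cases t) (auto simp: ucb_action_def nth_append ucb_hist.simps(2))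

lemma nth_ucb_hist: "r < n \<Longrightarrow> ucb_hist k Y n ! r = ucb_action k Y (Suc r)"
  by (induction n) (auto simp: ucb_action_eq nth_append less_Suc_eq ucb_hist.simps(2))

lemma pulls_Nil [simp]: "pulls [] i = 0"
  by (simp add: pulls_def)

lemma pulls_ucb_hist_Suc:
  "pulls (ucb_hist k Y (Suc n)) i
     = pulls (ucb_hist k Y n) i + (if ucb_action k Y (Suc n) = i then 1 else 0)"
  by (simp add: pulls_def ucb_action_eq ucb_hist.simps(2))

lemma pulls_ucb_hist_mono: "m \<le> n \<Longrightarrow> pulls (ucb_hist k Y m) i \<le> pulls (ucb_hist k Y n) i"
  by (rule lift_Suc_mono_le[of "\<lambda>n. pulls (ucb_hist k Y n) i"]) (auto simp: pulls_ucb_hist_Suc)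

lemma pulls_ucb_hist_le: "pulls (ucb_hist k Y n) i \<le> n"
  unfolding pulls_def by (metis length_filter_le length_ucb_hist)

lemma ucb_action_initial: "1 \<le> t \<Longrightarrow> t \<le> k \<Longrightarrow> ucb_action k Y t = t"
  by (simp add: ucb_action_eq next_arm_def)

text \<open>The initial round pulls arm \<open>i\<close> at time \<open>i\<close>. After it every
  index is built from actual rewards: neither the default value 1 of \<open>emp_mean\<close> nor a
  division by zero occurs.\<close>

lemma pulls_ucb_hist_pos:
  assumes "i \<in> {1..k}" "k \<le> n"
  shows "0 < pulls (ucb_hist k Y n) i"
proof -
  have "0 < pulls (ucb_hist k Y (Suc (i - 1))) i"
    using assms by (subst pulls_ucb_hist_Suc) (auto simp: ucb_action_initial)
  also have "\<dots> \<le> pulls (ucb_hist k Y n) i"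
    using assms by (intro pulls_ucb_hist_mono) auto
  finally show ?thesis .
qed

lemma next_arm_props:
  assumes "1 \<le> k" "k < t"
  shows "next_arm k Y hs t \<in> {1..k} \<and>
    (\<forall>j\<in>{1..k}. ucb_index Y hs t j \<le> ucb_index Y hs t (next_arm k Y hs t))"
proof -
  let ?v = "ucb_index Y hs t"
  let ?P = "\<lambda>i. i \<in> {1..k} \<and> (\<forall>j\<in>{1..k}. ?v j \<le> ?v i)"
  have ne: "finite (?v ` {1..k})" "?v ` {1..k} \<noteq> {}"
    using assms by auto
  obtain i where "i \<in> {1..k}" "?v i = Max (?v ` {1..k})"
    using Max_in[OF ne] by auto
  hence "?P i"
    using ne by auto
  hence "?P (LEAST i. ?P i)"
    by (rule LeastI)
  moreover have eq: "next_arm k Y hs t = (LEAST i. ?P i)"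
    using assms(2) by (simp add: next_arm_def)
  ultimately show ?thesis
    unfolding eq by blast
qed

lemma ucb_action_range: "1 \<le> k \<Longrightarrow> 1 \<le> t \<Longrightarrow> ucb_action k Y t \<in> {1..k}"
  using next_arm_props[of k t Y "ucb_hist k Y (t - 1)"]
  by (cases "t \<le> k") (auto simp: ucb_action_eq next_arm_def)

text \<open>Predictability: the arm for time \<open>n + 1\<close> is chosen from the rewards at
  times up to \<open>n\<close>, so agreement of the tables may stop one time before the end of the
  history.\<close>

lemma ucb_hist_cong:
  assumes "\<And>i s. s \<le> n \<Longrightarrow> Y i s = Z i s"
  shows "ucb_hist k Y (Suc n) = ucb_hist k Z (Suc n)"
  using assms
proof (induction n)
  \<comment> \<open>The first arm is chosen from the empty history, on which every empirical mean is
    the default 1, so no reward is read.\<close>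
  case 0
  show ?case by (simp add: ucb_hist.simps(2) next_arm_def ucb_index_def emp_mean_def pulls_def)
next
  case (Suc n)
  have IH: "ucb_hist k Y (Suc n) = ucb_hist k Z (Suc n)"
    by (rule Suc.IH) (use Suc.prems in auto)
  have "emp_mean Y hs = emp_mean Z hs" if "length hs = Suc n" for hs
    unfolding emp_mean_def using that Suc.prems by (auto intro!: ext sum.cong)
  from this[of "ucb_hist k Y (Suc n)"]
  have "next_arm k Y (ucb_hist k Y (Suc n)) (Suc (Suc n))
      = next_arm k Z (ucb_hist k Y (Suc n)) (Suc (Suc n))"
    unfolding next_arm_def ucb_index_def length_ucb_hist by simp
  thus ?case
    using IH by (simp only: ucb_hist.simps(2)[of k _ "Suc n"])
qed

text \<open>The numerator of \<open>emp_mean\<close> on the history that UCB itself generates from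
  \<open>Y\<close>, in a form that grows by one summand per time.\<close>

definition reward_sum :: "nat \<Rightarrow> (nat \<Rightarrow> nat \<Rightarrow> real) \<Rightarrow> nat \<Rightarrow> nat \<Rightarrow> real" where
  "reward_sum k Y n i = (\<Sum>r<n. if ucb_action k Y (Suc r) = i then Y i (Suc r) else 0)"

lemma emp_mean_ucb_hist:
  "pulls (ucb_hist k Y n) i \<noteq> 0 \<Longrightarrow>
    emp_mean Y (ucb_hist k Y n) i = reward_sum k Y n i / pulls (ucb_hist k Y n) i"
  by (auto simp: emp_mean_def reward_sum_def nth_ucb_hist intro!: sum.cong arg_cong2[where f="(/)"])

text \<open>The exponential supermartingale of arm \<open>j\<close>, stopped once the arm has been pulled \<open>s\<close> times.
Stopping makes it carry information about the first \<open>s\<close> rewards of the arm whatever the random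
time at which they were collected, so Markov's inequality applies at the fixed time \<open>n\<close>.\<close>
definition tilt :: "nat \<Rightarrow> (nat \<Rightarrow> nat \<Rightarrow> real) \<Rightarrow> nat \<Rightarrow> real \<Rightarrow> real \<Rightarrow> nat \<Rightarrow> nat \<Rightarrow> real" where
  "tilt k Y j m l s n =
     (\<Prod>r<n. if ucb_action k Y (Suc r) = j \<and> pulls (ucb_hist k Y r) j < s
              then exp (l * (Y j (Suc r) - m) - l\<^sup>2 / 2) else 1)"

lemma tilt_nonneg: "0 \<le> tilt k Y j m l s n"
  unfolding tilt_def by (intro prod_nonneg) auto

text \<open>Up to the \<open>s\<close>-th pull every pull of \<open>j\<close> has contributed its
  factor, so the product collapses to one exponential of the centred reward sum. Allowing fewer than
  \<open>s\<close> pulls makes the induction go through.\<close>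

lemma tilt_eq_aux:
  fixes m l :: real
  shows
  "pulls (ucb_hist k Y n) j \<le> s \<Longrightarrow>
    tilt k Y j m l s n = exp (l * (reward_sum k Y n j - pulls (ucb_hist k Y n) j * m)
                               - pulls (ucb_hist k Y n) j * (l\<^sup>2 / 2))"
proof (induction n)
  case (Suc n)
  have "pulls (ucb_hist k Y n) j \<le> s"
    using Suc.prems by (auto simp: pulls_ucb_hist_Suc split: if_splits)
  note IH = Suc.IH[OF this]
  show ?case
  proof (cases "ucb_action k Y (Suc n) = j")
    case True
    hence "pulls (ucb_hist k Y n) j < s"
      using Suc.prems by (auto simp: pulls_ucb_hist_Suc)
    hence "tilt k Y j m l s (Suc n) = tilt k Y j m l s n * exp (l * (Y j (Suc n) - m) - l\<^sup>2 / 2)"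
      using True by (simp add: tilt_def)
    also have "\<dots> = exp (l * (reward_sum k Y (Suc n) j - pulls (ucb_hist k Y (Suc n)) j * m)
                               - pulls (ucb_hist k Y (Suc n)) j * (l\<^sup>2 / 2))"
      using True unfolding IH exp_add[symmetric]
      by (simp add: pulls_ucb_hist_Suc reward_sum_def algebra_simps)
    finally show ?thesis .
  next
    case False
    thus ?thesis
      using IH by (simp add: tilt_def pulls_ucb_hist_Suc reward_sum_def)
  qed
qed (simp add: tilt_def reward_sum_def)

text \<open>After time \<open>t\<close> the stopping condition makes every further factor 1, so the
  value at the fixed time \<open>n\<close> still shows the reward sum of exactly \<open>s\<close>
  pulls.\<close>

lemma tilt_eq:
  fixes m l :: real
  assumes "t \<le> n" "pulls (ucb_hist k Y t) j = s"
  shows "tilt k Y j m l s n = exp (l * (reward_sum k Y t j - s * m) - s * (l\<^sup>2 / 2))"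
  using assms(1)
proof (induction n rule: dec_induct)
  case base
  show ?case using tilt_eq_aux[of k Y t j s m l] assms by simp
next
  case (step n)
  have "s \<le> pulls (ucb_hist k Y n) j"
    using pulls_ucb_hist_mono[OF step.hyps(1)] assms(2) by blast
  thus ?case using step.IH by (simp add: tilt_def)
qed

text \<open>When the average of \<open>s\<close> rewards deviates from \<open>m\<close> by
  \<open>l\<close> or more (upwards for \<open>l > 0\<close>, downwards for \<open>l < 0\<close>),
  the exponent of \<open>tilt\<close> is at least \<open>s * l^2 / 2\<close>. The indicator of the
  deviation is thus dominated by a quantity with controlled mean: a Chernoff bound done
  pathwise.\<close>

lemma tilt_ge:
  fixes m l :: real
  assumes "t \<le> n" "pulls (ucb_hist k Y t) j = s"
    and "l * (reward_sum k Y t j - s * m) \<ge> s * l\<^sup>2"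
  shows "1 \<le> exp (- (s * l\<^sup>2 / 2)) * tilt k Y j m l s n"
  unfolding tilt_eq[OF assms(1,2)] exp_add[symmetric] using assms(3) by simp

lemma f_ucb_ge_1: "0 \<le> t \<Longrightarrow> 1 \<le> f_ucb t"
  by (simp add: f_ucb_def)

lemma f_ucb_mono: "1 \<le> s \<Longrightarrow> s \<le> t \<Longrightarrow> f_ucb s \<le> f_ucb t"
  unfolding f_ucb_def by (intro add_mono mult_mono power_mono) auto

text \<open>A pull of \<open>i\<close> after the initial round means that the index of \<open>b\<close> falls below the midpoint
\<open>m + D / 2\<close> of the two means or the index of \<open>i\<close> exceeds it. In the second case the confidence width
is at most \<open>D / 4\<close> once \<open>i\<close> has \<open>32 ln f(T) / D\<^sup>2\<close> pulls.\<close>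
lemma ucb_pulls_bound:
  fixes k T i b :: nat and m D :: real
  assumes k: "1 \<le> k" and i: "i \<in> {1..k}" and b: "b \<in> {1..k}" and D: "0 < D"
  shows "(\<Sum>t\<in>{1..T}. of_bool (ucb_action k Y t = i))
     \<le> 1 + 32 * ln (f_ucb T) / D\<^sup>2
       + (\<Sum>s\<in>{1..T}. exp (- (s * (D / 4)\<^sup>2 / 2)) * tilt k Y i m (D / 4) s T)
       + (\<Sum>t\<in>{2..T}. \<Sum>s\<in>{1..T}.
            exp (- (s * (D / 2 + sqrt (2 * ln (f_ucb t) / s))\<^sup>2 / 2))
            * tilt k Y b (m + D) (- (D / 2 + sqrt (2 * ln (f_ucb t) / s))) s T)"
proof -
  define ind where "ind t j = ucb_index Y (ucb_hist k Y (t - 1)) t j" for t j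
  define N where "N t j = pulls (ucb_hist k Y (t - 1)) j" for t j
  define a where "a = ucb_action k Y"
  define E where "E = {t\<in>{1..T}. t \<le> k \<and> a t = i}"
  define E2 where "E2 = {t\<in>{k<..T}. a t = i \<and> ind t b \<le> m + D / 2}"
  define E3 where "E3 = {t\<in>{k<..T}. a t = i \<and> ind t i \<ge> m + D / 2}"
  define u where "u = 32 * ln (f_ucb T) / D\<^sup>2"
  \<comment> \<open>\<open>x t s\<close> is how far the average of \<open>s\<close> rewards of
    \<open>b\<close> has to lie below its mean \<open>m + D\<close> for the index of
    \<open>b\<close> at time \<open>t\<close> to be at most \<open>m + D / 2\<close>.\<close>
  define x where "x t s = D / 2 + sqrt (2 * ln (f_ucb (real t)) / real s)" for t s :: nat
  have ind: "ind t j = reward_sum k Y (t - 1) j / N t j + sqrt (2 * ln (f_ucb t) / N t j)"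
    and Npos: "0 < N t j" and NT: "N t j \<in> {1..T}"
    if "t \<in> {k<..T}" "j \<in> {1..k}" for t j
  proof -
    show pos: "0 < N t j"
      using that pulls_ucb_hist_pos[of j k "t - 1" Y] by (auto simp: N_def)
    thus "ind t j = reward_sum k Y (t - 1) j / N t j + sqrt (2 * ln (f_ucb t) / N t j)"
      unfolding ind_def ucb_index_def N_def by (subst emp_mean_ucb_hist) auto
    show "N t j \<in> {1..T}"
      using pos pulls_ucb_hist_le[of k Y "t - 1" j] that by (auto simp: N_def)
  qed
  have ln_nonneg: "0 \<le> ln (f_ucb (real t))" for t :: nat
    by (simp add: f_ucb_ge_1)
  have u_nonneg: "0 \<le> u"
    unfolding u_def using ln_nonneg by simp
  have sub: "{t\<in>{1..T}. a t = i} \<subseteq> E \<union> E2 \<union> E3"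
  proof
    fix t assume t: "t \<in> {t\<in>{1..T}. a t = i}"
    show "t \<in> E \<union> E2 \<union> E3"
    proof (cases "t \<le> k")
      case False
      hence "ind t b \<le> ind t i"
        using next_arm_props[of k t Y "ucb_hist k Y (t - 1)"] k b t
        by (auto simp: ind_def a_def ucb_action_eq)
      thus ?thesis using False t by (auto simp: E2_def E3_def)
    qed (use t in \<open>auto simp: E_def\<close>)
  qed
  have fin: "finite E" "finite E2" "finite E3"
    by (auto simp: E_def E2_def E3_def)
  have "(\<Sum>t\<in>{1..T}. of_bool (ucb_action k Y t = i)) = real (card {t\<in>{1..T}. a t = i})"
    by (simp add: of_bool_def a_def sum.If_cases Int_def flip: sum.inter_filter)
  also have "\<dots> \<le> real (card E + card E2 + card E3)"
    using card_mono[OF _ sub] fin card_Un_le[of "E \<union> E2" E3] card_Un_le[of E E2]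
    by (intro of_nat_mono) (auto simp: E_def E2_def E3_def)
  finally have main: "(\<Sum>t\<in>{1..T}. of_bool (ucb_action k Y t = i))
      \<le> real (card E) + real (card E2) + real (card E3)" by simp
  have "E \<subseteq> {i}"
    by (auto simp: E_def a_def ucb_action_initial)
  hence c1: "real (card E) \<le> 1"
    using card_mono[of "{i}" E] by simp
  have "real (card E2) = (\<Sum>t\<in>E2. 1)" by simp
  also have "\<dots> \<le> (\<Sum>t\<in>E2. \<Sum>s\<in>{1..T}. exp (- (s * (x t s)\<^sup>2 / 2)) * tilt k Y b (m + D) (- x t s) s T)"
  proof (rule sum_mono)
    fix t assume t: "t \<in> E2"
    let ?s = "N t b" and ?S = "reward_sum k Y (t - 1) b"
    have t': "t \<in> {k<..T}" using t by (simp add: E2_def)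
    have pos: "0 < ?s" and le: "?S / ?s + sqrt (2 * ln (f_ucb t) / ?s) \<le> m + D / 2"
      using Npos[OF t' b] ind[OF t' b] t by (auto simp: E2_def)
    have "?S / ?s \<le> m + D - x t ?s"
      using le by (simp add: x_def)
    hence "?S - ?s * (m + D) \<le> - (?s * x t ?s)"
      using pos by (simp add: field_simps)
    moreover have "0 \<le> x t ?s"
      using D ln_nonneg by (simp add: x_def)
    ultimately have "x t ?s * (?S - ?s * (m + D)) \<le> x t ?s * (- (?s * x t ?s))"
      by (rule mult_left_mono)
    hence "- x t ?s * (?S - ?s * (m + D)) \<ge> ?s * (- x t ?s)\<^sup>2"
      by (simp add: power2_eq_square algebra_simps)
    from tilt_ge[OF _ _ this, of T] t'
    have "1 \<le> exp (- (?s * (x t ?s)\<^sup>2 / 2)) * tilt k Y b (m + D) (- x t ?s) ?s T"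
      by (auto simp: N_def)
    \<comment> \<open>The pull count of \<open>b\<close> at time \<open>t\<close> is random; it is
      covered by a sum over all its possible values.\<close>
    also have "\<dots> \<le> (\<Sum>s\<in>{1..T}. exp (- (s * (x t s)\<^sup>2 / 2)) * tilt k Y b (m + D) (- x t s) s T)"
      using NT[OF t' b] by (intro member_le_sum) (auto intro!: mult_nonneg_nonneg tilt_nonneg)
    finally show "1 \<le> \<dots>" .
  qed
  \<comment> \<open>Times after the initial round are at least 2, the range on which the sum of
    \<open>1 / f_ucb t\<close> is bounded later.\<close>
  also have "\<dots> \<le> (\<Sum>t\<in>{2..T}. \<Sum>s\<in>{1..T}. exp (- (s * (x t s)\<^sup>2 / 2)) * tilt k Y b (m + D) (- x t s) s T)"
    using k by (intro sum_mono2) (auto simp: E2_def intro!: sum_nonneg mult_nonneg_nonneg tilt_nonneg)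
  finally have c2: "real (card E2) \<le> \<dots>" .
  \<comment> \<open>Every pull of \<open>i\<close> raises its count, so the times in
    \<open>E3\<close> have distinct counts. Reindexing by the count leaves one sum over
    \<open>s\<close> instead of a double sum over \<open>t\<close> and \<open>s\<close>.\<close>
  have inj: "inj_on (\<lambda>t. N t i) E3"
  proof (rule linorder_inj_onI)
    fix t t' assume tt: "t < t'" "t \<in> E3" "t' \<in> E3"
    have "Suc (N t i) = pulls (ucb_hist k Y (Suc (t - 1))) i"
      using tt by (subst pulls_ucb_hist_Suc) (auto simp: N_def E3_def a_def)
    also have "\<dots> \<le> N t' i"
      unfolding N_def using tt by (intro pulls_ucb_hist_mono) (auto simp: E3_def)
    finally show "N t i \<noteq> N t' i" by simp
  qed auto
  have "real (card E3) = (\<Sum>s\<in>(\<lambda>t. N t i) ` E3. 1)"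
    using inj by (simp add: card_image)
  \<comment> \<open>Counts below \<open>u\<close>, where the confidence width may still be large,
    are simply counted. For the others the average of \<open>i\<close> exceeds \<open>m\<close> by
    at least \<open>D / 4\<close>.\<close>
  also have "\<dots> \<le> (\<Sum>s\<in>(\<lambda>t. N t i) ` E3.
      of_bool (real s < u) + exp (- (s * (D / 4)\<^sup>2 / 2)) * tilt k Y i m (D / 4) s T)"
  proof (rule sum_mono)
    fix s assume "s \<in> (\<lambda>t. N t i) ` E3"
    then obtain t where t: "t \<in> E3" "s = N t i" by auto
    let ?S = "reward_sum k Y (t - 1) i"
    have t': "t \<in> {k<..T}" using t by (simp add: E3_def)
    have pos: "0 < s" and ge: "m + D / 2 \<le> ?S / s + sqrt (2 * ln (f_ucb t) / s)"
      using Npos[OF t' i] ind[OF t' i] t by (auto simp: E3_def)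
    show "1 \<le> of_bool (real s < u) + exp (- (s * (D / 4)\<^sup>2 / 2)) * tilt k Y i m (D / 4) s T"
    proof (cases "real s < u")
      case False
      have "ln (f_ucb t) \<le> ln (f_ucb T)"
        using t' k f_ucb_ge_1[of t] by (intro ln_mono f_ucb_mono) auto
      moreover have "32 * ln (f_ucb T) \<le> s * D\<^sup>2"
        using False D by (simp add: u_def field_simps)
      ultimately have "2 * ln (f_ucb t) / s \<le> (D / 4)\<^sup>2"
        using pos by (simp add: field_simps power_divide)
      hence "sqrt (2 * ln (f_ucb t) / s) \<le> D / 4"
        using D by (intro real_le_lsqrt) auto
      hence "m + D / 4 \<le> ?S / s" using ge by simp
      hence "s * (D / 4) \<le> ?S - s * m"
        using pos by (simp add: field_simps)
      hence "D / 4 * (s * (D / 4)) \<le> D / 4 * (?S - s * m)"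
        using D by (intro mult_left_mono) auto
      hence "D / 4 * (?S - s * m) \<ge> s * (D / 4)\<^sup>2"
        by (simp add: power2_eq_square algebra_simps)
      moreover have "t - 1 \<le> T" "pulls (ucb_hist k Y (t - 1)) i = s"
        using t' t(2) by (auto simp: N_def)
      ultimately have "1 \<le> exp (- (s * (D / 4)\<^sup>2 / 2)) * tilt k Y i m (D / 4) s T"
        by (intro tilt_ge)
      thus ?thesis using False by simp
    qed (simp add: tilt_nonneg)
  qed
  also have "\<dots> \<le> (\<Sum>s\<in>{1..T}.
      of_bool (real s < u) + exp (- (s * (D / 4)\<^sup>2 / 2)) * tilt k Y i m (D / 4) s T)"
    using NT[OF _ i]
    by (intro sum_mono2) (auto simp: E3_def tilt_nonneg)
  also have "\<dots> = (\<Sum>s\<in>{1..T}. of_bool (real s < u))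
      + (\<Sum>s\<in>{1..T}. exp (- (s * (D / 4)\<^sup>2 / 2)) * tilt k Y i m (D / 4) s T)"
    by (rule sum.distrib)
  also have "(\<Sum>s\<in>{1..T}. of_bool (real s < u)) \<le> u"
  proof -
    have "(\<Sum>s\<in>{1..T}. of_bool (real s < u)) = real (card {s\<in>{1..T}. real s < u})"
      by (simp add: of_bool_def sum.If_cases Int_def flip: sum.inter_filter)
    also have "card {s\<in>{1..T}. real s < u} \<le> card {1..nat \<lfloor>u\<rfloor>}"
      by (intro card_mono) (auto simp: le_nat_floor)
    also have "real (card {1..nat \<lfloor>u\<rfloor>}) \<le> u"
      using u_nonneg by simp
    finally show ?thesis by simp
  qed
  finally have "real (card E3) \<le>
      u + (\<Sum>s\<in>{1..T}. exp (- (s * (D / 4)\<^sup>2 / 2)) * tilt k Y i m (D / 4) s T)"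
    by simp
  thus ?thesis
    using main c1 c2 unfolding u_def x_def by linarith
qed

section \<open>Two series bounds\<close>

lemma geometric_exp_bound:
  fixes a :: real
  assumes "0 < a"
  shows "(\<Sum>s\<in>{1..n}. exp (- (real s * a))) \<le> 1 / a"
proof -
  let ?q = "exp (- a)"
  have q: "0 < ?q" "?q < 1" using assms by auto
  have "(\<Sum>s\<in>{1..n}. exp (- (real s * a))) = (\<Sum>s\<in>{1..n}. ?q ^ s)"
    by (simp flip: exp_of_nat_mult)
  also have "\<dots> = ?q * (1 - ?q ^ n) / (1 - ?q)"
    using q by (simp add: sum_gp sum_gp_multiplied field_simps)
  also have "\<dots> \<le> ?q / (1 - ?q)"
    using q by (intro divide_right_mono) (auto simp: algebra_simps)
  also have "\<dots> = 1 / (exp a - 1)"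
    using assms by (simp add: exp_minus field_simps)
  also have "\<dots> \<le> 1 / a"
  proof -
    have "a \<le> exp a - 1" using exp_ge_add_one_self[of a] by linarith
    thus ?thesis using assms by (intro divide_left_mono) auto
  qed
  finally show ?thesis .
qed

text \<open>For \<open>t >= 3\<close> the terms are compared with the telescoping differences
  \<open>1 / ln (t - 1) - 1 / ln t\<close>; the term at \<open>t = 2\<close> is at most 1. The
  remainder \<open>- 1 / ln T\<close> is kept so that the induction closes, and
  \<open>ln 2 >= 2 / 3\<close> gives the constant.\<close>

lemma sum_inverse_f_ucb: "(\<Sum>t\<in>{2..T}. 1 / f_ucb (real t)) \<le> 5 / 2"
proof (cases "2 \<le> T")
  case True
  have "(\<Sum>t\<in>{2..T}. 1 / f_ucb (real t)) \<le> 1 + 1 / ln 2 - 1 / ln (real T)"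
    using True
  proof (induction T rule: dec_induct)
    case base
    show ?case using f_ucb_ge_1[of 2] by simp
  next
    case (step n)
    have n: "1 < real n" "0 < ln (real n)" "ln (real n) \<le> ln (real (Suc n))" using step by auto
    have "ln (real n / real (Suc n)) \<le> real n / real (Suc n) - 1"
      using n by (intro ln_le_minus_one) auto
    hence "1 / real (Suc n) \<le> ln (real (Suc n)) - ln (real n)"
      using n by (simp add: ln_div field_simps)
    \<comment> \<open>One of the two factors \<open>ln (n + 1)\<close> in the denominator is lowered
      to \<open>ln n\<close>, which produces the telescoping difference.\<close>
    hence "1 / real (Suc n) / (ln (real (Suc n)))\<^sup>2
        \<le> (ln (real (Suc n)) - ln (real n)) / (ln (real (Suc n)) * ln (real n))"
      using n by (intro frac_le) (auto simp: power2_eq_square)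
    also have "\<dots> = 1 / ln (real n) - 1 / ln (real (Suc n))"
      using n by (simp add: field_simps)
    finally have "1 / (real (Suc n) * (ln (real (Suc n)))\<^sup>2) \<le> 1 / ln (real n) - 1 / ln (real (Suc n))"
      by simp
    moreover have "1 / f_ucb (real (Suc n)) \<le> 1 / (real (Suc n) * (ln (real (Suc n)))\<^sup>2)"
      unfolding f_ucb_def using n by (intro divide_left_mono) (auto intro!: mult_pos_pos add_pos_pos)
    ultimately show ?case using step by simp
  qed
  also have "\<dots> \<le> 1 + 1 / ln 2"
    using True by simp
  also have "\<dots> \<le> 5 / 2"
    using ln2_ge_two_thirds by (simp add: field_simps)
  finally show ?thesis .
qed simp

subsection \<open>Expected number of pulls\<close>

lemma measurable_PiM_coordinate:
  assumes "\<And>p. p \<in> I \<Longrightarrow> sets (M p) = sets (borel :: real measure)"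
  shows "(\<lambda>w. w p) \<in> borel_measurable (PiM I M)"
proof (cases "p \<in> I")
  case True
  hence "(\<lambda>w. w p) \<in> PiM I M \<rightarrow>\<^sub>M M p"
    by (rule measurable_component_singleton)
  also have "PiM I M \<rightarrow>\<^sub>M M p = borel_measurable (PiM I M)"
    by (intro measurable_cong_sets refl assms True)
  finally show ?thesis .
next
  case False
  \<comment> \<open>Outside \<open>I\<close> every point of the product space takes the value
    \<open>undefined\<close>, so the coordinate is constant. Hence all table entries are measurable,
    also those at indices that the product does not carry.\<close>
  have "(\<lambda>w. w p) \<in> borel_measurable (PiM I M)
      \<longleftrightarrow> (\<lambda>_. undefined :: real) \<in> borel_measurable (PiM I M)"
    by (rule measurable_cong) (metis False PiE_arb space_PiM)
  thus ?thesis by simp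
qed

lemma measurable_ucb_index:
  assumes [measurable]: "\<And>i s. (\<lambda>w. Y w i s) \<in> borel_measurable M"
  shows "(\<lambda>w. ucb_index (Y w) hs t i) \<in> borel_measurable M"
proof -
  have "(\<lambda>w. \<Sum>s<length hs. if hs ! s = i then Y w i (Suc s) else 0) \<in> borel_measurable M"
    by (rule borel_measurable_sum) (auto intro: assms)
  thus ?thesis
    unfolding ucb_index_def emp_mean_def by (cases "pulls hs i = 0") simp_all
qed

lemma measurable_next_arm:
  assumes "\<And>i s. (\<lambda>w. Y w i s) \<in> borel_measurable M"
  shows "(\<lambda>w. next_arm k (Y w) hs t) \<in> M \<rightarrow>\<^sub>M count_space UNIV"
proof (cases "t \<le> k")
  case True
  thus ?thesis by (simp add: next_arm_def)
next
  case False
  have [measurable]: "Measurable.pred M (\<lambda>w. ucb_index (Y w) hs t j \<le> ucb_index (Y w) hs t i)" for i j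
    unfolding Measurable.pred_def
    by (intro borel_measurable_le measurable_ucb_index[of Y] assms)
  have "Measurable.pred M (\<lambda>w. i \<in> {1..k} \<and>
      (\<forall>j\<in>{1..k}. ucb_index (Y w) hs t j \<le> ucb_index (Y w) hs t i))" for i
    by measurable
  from measurable_Least[OF this] show ?thesis
    using False by (simp add: next_arm_def)
qed

text \<open>Histories range over a countable type, so measurability of the next arm may be checked
  with the history held fixed.\<close>

lemma measurable_ucb_hist:
  assumes "\<And>i s. (\<lambda>w. Y w i s) \<in> borel_measurable M"
  shows "(\<lambda>w. ucb_hist k (Y w) n) \<in> M \<rightarrow>\<^sub>M count_space UNIV"
proof (induction n)
  case (Suc n)
  have "(\<lambda>w. hs @ [next_arm k (Y w) hs (Suc n)]) \<in> M \<rightarrow>\<^sub>M count_space UNIV" for hs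
    by (rule measurable_compose[OF measurable_next_arm[of Y, OF assms]]) simp
  from measurable_compose_countable[OF this Suc] show ?case
    by (simp add: ucb_hist.simps(2))
qed simp

lemma measurable_ucb_action:
  assumes "\<And>i s. (\<lambda>w. Y w i s) \<in> borel_measurable M"
  shows "(\<lambda>w. ucb_action k (Y w) t) \<in> M \<rightarrow>\<^sub>M count_space UNIV"
  unfolding ucb_action_def
  by (rule measurable_compose[OF measurable_ucb_hist[of Y, OF assms]]) simp

lemma measurable_tilt:
  assumes "\<And>i s. (\<lambda>w. Y w i s) \<in> borel_measurable M"
  shows "(\<lambda>w. tilt k (Y w) j m l s n) \<in> borel_measurable M"
proof -
  have pred: "Measurable.pred M (\<lambda>w. ucb_action k (Y w) (Suc r) = j \<and> pulls (ucb_hist k (Y w) r) j < s)" for r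
    by (intro pred_intros_logic
          measurable_compose[OF measurable_ucb_action[of Y, OF assms], where g = "\<lambda>a. a = j"]
          measurable_compose[OF measurable_ucb_hist[of Y, OF assms], where g = "\<lambda>hs. pulls hs j < s"])
       simp_all
  have "(\<lambda>w. exp (l * (Y w j (Suc r) - m) - l\<^sup>2 / 2)) \<in> borel_measurable M" for r
    by (rule measurable_compose[OF assms]) measurable
  thus ?thesis
    unfolding tilt_def using pred
    by (intro borel_measurable_prod measurable_If) (auto simp: Measurable.pred_def)
qed

section \<open>Dependence on past rewards only\<close>

lemma ucb_action_cong:
  assumes "\<And>i s. s \<le> n \<Longrightarrow> Y i s = Z i s" "t \<le> Suc n"
  shows "ucb_action k Y t = ucb_action k Z t"
proof (cases t)
  case 0
  thus ?thesis by (simp add: ucb_action_def)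
next
  case (Suc t')
  have "ucb_hist k Y (Suc t') = ucb_hist k Z (Suc t')"
    by (rule ucb_hist_cong) (use assms Suc in auto)
  thus ?thesis by (simp add: ucb_action_def Suc)
qed

lemma pulls_ucb_hist_cong:
  assumes "\<And>i s. s \<le> n \<Longrightarrow> Y i s = Z i s" "t \<le> Suc n"
  shows "pulls (ucb_hist k Y t) i = pulls (ucb_hist k Z t) i"
  using assms(2)
proof (induction t)
  case (Suc t)
  hence "ucb_action k Y (Suc t) = ucb_action k Z (Suc t)"
    by (intro ucb_action_cong[of n Y Z] assms(1))
  thus ?case using Suc by (simp add: pulls_ucb_hist_Suc)
qed simp

text \<open>Adaptedness, the counterpart of the predictability of the actions: the reward at time
  \<open>n + 1\<close> can be integrated out while the product up to \<open>n\<close> stands as a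
  constant factor.\<close>

lemma tilt_cong:
  assumes "\<And>i s. s \<le> n \<Longrightarrow> Y i s = Z i s"
  shows "tilt k Y j m l s n = tilt k Z j m l s n"
  unfolding tilt_def
proof (intro prod.cong refl)
  fix r assume "r \<in> {..<n}"
  hence "ucb_action k Y (Suc r) = ucb_action k Z (Suc r)"
    "pulls (ucb_hist k Y r) j = pulls (ucb_hist k Z r) j" "Y j (Suc r) = Z j (Suc r)"
    by (auto intro!: ucb_action_cong[of n Y Z] pulls_ucb_hist_cong[of n Y Z] assms)
  thus "(if ucb_action k Y (Suc r) = j \<and> pulls (ucb_hist k Y r) j < s
          then exp (l * (Y j (Suc r) - m) - l\<^sup>2 / 2) else 1)
      = (if ucb_action k Z (Suc r) = j \<and> pulls (ucb_hist k Z r) j < s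
          then exp (l * (Z j (Suc r) - m) - l\<^sup>2 / 2) else 1)"
    by simp
qed

section \<open>Independent subgaussian rewards for fixed means\<close>

locale bandit_rewards = product_prob_space M "{1..k} \<times> {1..T}"
  for M :: "nat \<times> nat \<Rightarrow> real measure" and k T :: nat +
  fixes mu :: "nat \<Rightarrow> real"
  assumes k_pos: "1 \<le> k"
    and sets_M: "\<And>p. sets (M p) = sets borel"
    and subgaussian: "\<And>i t l. i \<in> {1..k} \<Longrightarrow> t \<in> {1..T} \<Longrightarrow>
          (\<integral>\<^sup>+z. ennreal (exp (l * (z - mu i))) \<partial>M (i, t)) \<le> ennreal (exp (l\<^sup>2 / 2))"
begin

declare One_nat_def [simp del]

abbreviation "Arms \<equiv> {1..k} \<times> {1..T}"

abbreviation table :: "(nat \<times> nat \<Rightarrow> real) \<Rightarrow> nat \<Rightarrow> nat \<Rightarrow> real" where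
  "table w \<equiv> \<lambda>i s. w (i, s)"

lemma measurable_table: "(\<lambda>w. table w i s) \<in> borel_measurable (PiM J M)"
  by (rule measurable_PiM_coordinate) (rule sets_M)

lemma measurable_tilt_table [measurable]:
  "(\<lambda>w. tilt k (table w) j m l s n) \<in> borel_measurable (PiM J M)"
  by (rule measurable_tilt[of table]) (rule measurable_table)

lemma measurable_pull_indicator:
  "(\<lambda>w. of_bool (ucb_action k (table w) t = i) :: real) \<in> borel_measurable (PiM J M)"
proof -
  have "(\<lambda>w. ucb_action k (table w) t) \<in> PiM J M \<rightarrow>\<^sub>M count_space UNIV"
    by (rule measurable_ucb_action[of table]) (rule measurable_table)
  from measurable_compose[OF this, of "\<lambda>a. of_bool (a = i) :: real"] show ?thesis by simp
qed

lemma measurable_M [measurable_cong]: "sets (M p) = sets borel"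
  by (rule sets_M)

text \<open>The supermartingale property. From \<open>n\<close> to \<open>n + 1\<close> only the
  reward of \<open>j\<close> at time \<open>n + 1\<close> is integrated, all other entries being
  held fixed. Whether the new factor is active is already decided by earlier rewards, and
  subgaussianity makes an active factor integrate to at most 1.\<close>

lemma nn_integral_tilt_le_1:
  assumes j: "j \<in> {1..k}"
  shows "n \<le> T \<Longrightarrow> (\<integral>\<^sup>+w. ennreal (tilt k (table w) j (mu j) l s n) \<partial>PiM Arms M) \<le> 1"
proof (induction n)
  case 0
  show ?case by (simp add: tilt_def P.emeasure_space_1)
next
  case (Suc n)
  define p where "p = (j, Suc n)"
  define J where "J = Arms - {p}"
  have J: "finite J" "p \<notin> J" "Arms = insert p J"
    using j Suc.prems by (auto simp: J_def p_def)
  let ?W = "\<lambda>n w. ennreal (tilt k (table w) j (mu j) l s n)"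
  have W_upd: "?W n (w(p := y)) = ?W n w" for w y
    by (intro arg_cong[where f = ennreal] tilt_cong) (auto simp: p_def)
  have step: "(\<integral>\<^sup>+y. ?W (Suc n) (w(p := y)) \<partial>M p) \<le> ?W n w" for w
  proof -
    define c where "c \<longleftrightarrow> ucb_action k (table w) (Suc n) = j \<and> pulls (ucb_hist k (table w) n) j < s"
    have "ucb_action k (table (w(p := y))) (Suc n) = ucb_action k (table w) (Suc n)"
      "pulls (ucb_hist k (table (w(p := y))) n) j = pulls (ucb_hist k (table w) n) j" for y
      by (rule ucb_action_cong[of n] pulls_ucb_hist_cong[of n]; auto simp: p_def)+
    hence c: "ucb_action k (table (w(p := y))) (Suc n) = j
        \<and> pulls (ucb_hist k (table (w(p := y))) n) j < s \<longleftrightarrow> c" for y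
      unfolding c_def by simp
    have "(\<integral>\<^sup>+y. ?W (Suc n) (w(p := y)) \<partial>M p)
        = (\<integral>\<^sup>+y. ?W n w * ennreal (if c then exp (l * (y - mu j) - l\<^sup>2 / 2) else 1) \<partial>M p)"
    proof (rule nn_integral_cong)
      fix y
      have "tilt k (table (w(p := y))) j (mu j) l s (Suc n)
          = tilt k (table (w(p := y))) j (mu j) l s n
            * (if c then exp (l * (y - mu j) - l\<^sup>2 / 2) else 1)"
        by (simp only: tilt_def prod.lessThan_Suc c) (simp add: p_def)
      thus "?W (Suc n) (w(p := y)) = ?W n w * ennreal (if c then exp (l * (y - mu j) - l\<^sup>2 / 2) else 1)"
        using W_upd[of w y] by (simp only: ennreal_mult' tilt_nonneg)
    qed
    also have "\<dots> = ?W n w * (\<integral>\<^sup>+y. ennreal (if c then exp (l * (y - mu j) - l\<^sup>2 / 2) else 1) \<partial>M p)"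
      by (rule nn_integral_cmult) measurable
    also have "(\<integral>\<^sup>+y. ennreal (if c then exp (l * (y - mu j) - l\<^sup>2 / 2) else 1) \<partial>M p) \<le> 1"
    proof (cases c)
      case True
      have "(\<integral>\<^sup>+y. ennreal (exp (l * (y - mu j) - l\<^sup>2 / 2)) \<partial>M p)
          = (\<integral>\<^sup>+y. ennreal (exp (- (l\<^sup>2 / 2))) * ennreal (exp (l * (y - mu j))) \<partial>M p)"
        by (intro nn_integral_cong) (simp flip: ennreal_mult exp_add)
      also have "\<dots> = ennreal (exp (- (l\<^sup>2 / 2))) * (\<integral>\<^sup>+y. ennreal (exp (l * (y - mu j))) \<partial>M p)"
        by (rule nn_integral_cmult) measurable
      also have "\<dots> \<le> ennreal (exp (- (l\<^sup>2 / 2))) * ennreal (exp (l\<^sup>2 / 2))"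
        unfolding p_def using j Suc.prems by (intro mult_left_mono subgaussian) auto
      also have "\<dots> = 1"
        by (simp flip: ennreal_mult exp_add)
      finally show ?thesis using True by simp
    next
      case False
      thus ?thesis using M.emeasure_space_1 by simp
    qed
    finally show ?thesis by (simp add: mult_left_mono)
  qed
  have "(\<integral>\<^sup>+w. ?W (Suc n) w \<partial>PiM Arms M) = (\<integral>\<^sup>+w. (\<integral>\<^sup>+y. ?W (Suc n) (w(p := y)) \<partial>M p) \<partial>PiM J M)"
    unfolding J(3) by (rule product_nn_integral_insert) (use J in measurable)
  also have "\<dots> \<le> (\<integral>\<^sup>+w. ?W n w \<partial>PiM J M)"
    by (intro nn_integral_mono step)
  \<comment> \<open>The coordinate \<open>p\<close> is put back: the integrand ignores it and
    \<open>M p\<close> has mass 1, so the induction hypothesis on the full table applies.\<close>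
  also have "\<dots> = (\<integral>\<^sup>+w. (\<integral>\<^sup>+y. ?W n (w(p := y)) \<partial>M p) \<partial>PiM J M)"
  proof (rule nn_integral_cong)
    fix w
    show "?W n w = (\<integral>\<^sup>+y. ?W n (w(p := y)) \<partial>M p)"
      unfolding W_upd using M.emeasure_space_1 by simp
  qed
  also have "\<dots> = (\<integral>\<^sup>+w. ?W n w \<partial>PiM Arms M)"
    unfolding J(3) by (rule product_nn_integral_insert[symmetric]) (use J in measurable)
  also have "\<dots> \<le> 1" using Suc by simp
  finally show ?case .
qed

lemma integral_tilt:
  assumes "j \<in> {1..k}"
  shows "integrable (PiM Arms M) (\<lambda>w. tilt k (table w) j (mu j) l s T)"
    and "(\<integral>w. tilt k (table w) j (mu j) l s T \<partial>PiM Arms M) \<le> 1"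
proof -
  note le = nn_integral_tilt_le_1[OF assms order_refl, of l s]
  show "integrable (PiM Arms M) (\<lambda>w. tilt k (table w) j (mu j) l s T)"
  proof (rule integrableI_nonneg)
    show "(\<lambda>w. tilt k (table w) j (mu j) l s T) \<in> borel_measurable (PiM Arms M)"
      by (rule measurable_tilt_table)
  qed (use le in \<open>auto simp: tilt_nonneg intro: le_less_trans\<close>)
  have "ennreal (\<integral>w. tilt k (table w) j (mu j) l s T \<partial>PiM Arms M) \<le> ennreal 1"
    using le by (subst nn_integral_eq_integral[symmetric])
      (use \<open>integrable _ _\<close> in \<open>auto simp: tilt_nonneg\<close>)
  thus "(\<integral>w. tilt k (table w) j (mu j) l s T \<partial>PiM Arms M) \<le> 1"
    by (subst (asm) ennreal_le_iff) auto
qed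

text \<open>Expectations are taken in \<open>ucb_pulls_bound\<close>, where every
  \<open>tilt\<close> has mean at most 1. The upward deviations of \<open>i\<close> sum to at most
  \<open>32 / D^2\<close> and the downward deviations of \<open>b\<close> to at most
  \<open>5 / 2 * 8 / D^2 = 20 / D^2\<close>; together they give 52.\<close>

lemma expected_pulls_le:
  assumes i: "i \<in> {1..k}" and b: "b \<in> {1..k}" and lt: "mu i < mu b"
  shows "(\<integral>w. (\<Sum>t\<in>{1..T}. of_bool (ucb_action k (table w) t = i)) \<partial>PiM Arms M)
    \<le> 1 + (52 + 32 * ln (f_ucb T)) / (mu b - mu i)\<^sup>2"
proof -
  define D where "D = mu b - mu i"
  have D: "0 < D" "mu b = mu i + D" using lt by (auto simp: D_def)
  define x where "x t s = D / 2 + sqrt (2 * ln (f_ucb (real t)) / real s)" for t s :: nat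
  define A where "A w = (\<Sum>s\<in>{1..T}. exp (- (s * (D / 4)\<^sup>2 / 2)) * tilt k (table w) i (mu i) (D / 4) s T)" for w
  define B where "B w = (\<Sum>t\<in>{2..T}. \<Sum>s\<in>{1..T}.
            exp (- (s * (x t s)\<^sup>2 / 2)) * tilt k (table w) b (mu b) (- x t s) s T)" for w
  let ?E = "\<lambda>f. \<integral>w. f w \<partial>PiM Arms M"
  have int: "integrable (PiM Arms M) A" "integrable (PiM Arms M) B"
    unfolding A_def B_def using i b
    by (intro Bochner_Integration.integrable_sum integrable_mult_right integral_tilt; simp)+
  have "?E (\<lambda>w. \<Sum>t\<in>{1..T}. of_bool (ucb_action k (table w) t = i))
      \<le> ?E (\<lambda>w. 1 + 32 * ln (f_ucb T) / D\<^sup>2 + A w + B w)"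
  proof (rule integral_mono)
    show "integrable (PiM Arms M) (\<lambda>w. \<Sum>t\<in>{1..T}. of_bool (ucb_action k (table w) t = i) :: real)"
    proof (intro Bochner_Integration.integrable_sum P.integrable_const_bound[where B = 1])
      show "(\<lambda>w. of_bool (ucb_action k (table w) t = i) :: real) \<in> borel_measurable (PiM Arms M)" for t
        by (rule measurable_pull_indicator)
    qed auto
    show "(\<Sum>t\<in>{1..T}. of_bool (ucb_action k (table w) t = i))
        \<le> 1 + 32 * ln (f_ucb T) / D\<^sup>2 + A w + B w" for w
      using ucb_pulls_bound[OF k_pos i b D(1), of "table w" T "mu i"]
      unfolding A_def B_def x_def D(2) .
  qed (intro Bochner_Integration.integrable_add P.integrable_const int)
  also have "\<dots> = 1 + 32 * ln (f_ucb T) / D\<^sup>2 + ?E A + ?E B"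
    using int P.prob_space by (simp)
  also have "?E A \<le> 32 / D\<^sup>2"
  proof -
    have "?E A = (\<Sum>s\<in>{1..T}. exp (- (s * (D / 4)\<^sup>2 / 2)) * ?E (\<lambda>w. tilt k (table w) i (mu i) (D / 4) s T))"
      unfolding A_def using i
      by (subst Bochner_Integration.integral_sum) (auto intro!: integrable_mult_right integral_tilt)
    also have "\<dots> \<le> (\<Sum>s\<in>{1..T}. exp (- (s * (D\<^sup>2 / 32))))"
      by (intro sum_mono order.trans[OF mult_left_mono[OF integral_tilt(2)]])
         (use i in \<open>auto simp: power_divide\<close>)
    also have "\<dots> \<le> 1 / (D\<^sup>2 / 32)"
      using D by (intro geometric_exp_bound) auto
    finally show ?thesis by simp
  qed
  also have "?E B \<le> 20 / D\<^sup>2"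
  proof -
    have "?E B = (\<Sum>t\<in>{2..T}. \<Sum>s\<in>{1..T}. exp (- (s * (x t s)\<^sup>2 / 2)) *
        ?E (\<lambda>w. tilt k (table w) b (mu b) (- x t s) s T))"
      unfolding B_def using b
      by (subst Bochner_Integration.integral_sum)
        (auto intro!: integrable_mult_right integral_tilt Bochner_Integration.integrable_sum
          Bochner_Integration.integral_sum[THEN trans] sum.cong)
    also have "\<dots> \<le> (\<Sum>t\<in>{2..T}. \<Sum>s\<in>{1..T}. 1 / f_ucb t * exp (- (s * (D\<^sup>2 / 8))))"
    proof (intro sum_mono)
      fix t s assume ts: "t \<in> {2..T}" "s \<in> {1..T}"
      let ?L = "ln (f_ucb (real t))"
      have L: "0 \<le> ?L" "1 \<le> f_ucb (real t)" by (simp_all add: f_ucb_ge_1)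
      \<comment> \<open>Dropping the nonnegative cross term of the square separates the exponent:
        the width yields the factor \<open>1 / f_ucb t\<close>, the gap yields
        \<open>exp (- (s * (D^2 / 8)))\<close>, and the double sum becomes a product.\<close>
      have "(D / 2)\<^sup>2 + (sqrt (2 * ?L / s))\<^sup>2 \<le> (x t s)\<^sup>2"
        unfolding x_def power2_sum using D L by simp
      hence "s * ((D / 2)\<^sup>2 + 2 * ?L / s) \<le> s * (x t s)\<^sup>2"
        using L by (intro mult_left_mono) auto
      hence "s * (D\<^sup>2 / 8) + ?L \<le> s * (x t s)\<^sup>2 / 2"
        using ts by (simp add: field_simps power_divide)
      hence "exp (- (s * (x t s)\<^sup>2 / 2)) \<le> exp (- (?L + s * (D\<^sup>2 / 8)))"
        by simp
      also have "\<dots> = 1 / f_ucb t * exp (- (s * (D\<^sup>2 / 8)))"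
        using L by (simp only: exp_minus exp_add) (simp add: field_simps)
      finally have "exp (- (s * (x t s)\<^sup>2 / 2)) \<le> \<dots>" .
      moreover have "exp (- (s * (x t s)\<^sup>2 / 2)) * ?E (\<lambda>w. tilt k (table w) b (mu b) (- x t s) s T)
          \<le> exp (- (s * (x t s)\<^sup>2 / 2)) * 1"
        using b by (intro mult_left_mono integral_tilt) auto
      ultimately show "exp (- (s * (x t s)\<^sup>2 / 2)) * ?E (\<lambda>w. tilt k (table w) b (mu b) (- x t s) s T)
          \<le> 1 / f_ucb t * exp (- (s * (D\<^sup>2 / 8)))" by linarith
    qed
    also have "\<dots> = (\<Sum>t\<in>{2..T}. 1 / f_ucb t) * (\<Sum>s\<in>{1..T}. exp (- (s * (D\<^sup>2 / 8))))"
      by (simp add: sum_product)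
    also have "\<dots> \<le> 5 / 2 * (1 / (D\<^sup>2 / 8))"
      using D by (intro mult_mono sum_inverse_f_ucb geometric_exp_bound sum_nonneg) auto
    finally show ?thesis by simp
  qed
  finally show ?thesis
    unfolding D_def[symmetric] by (simp add: add_divide_distrib)
qed

text \<open>Regret is the sum over arms of gap times expected pulls. Each summand has two bounds:
  \<open>T * D\<close>, as there are \<open>T\<close> pulls in all, and \<open>D + C / D\<close>
  with \<open>D <= 1\<close>. The cut \<open>\<delta>\<close> selecting between them stays free
  until the average over the prior.\<close>

lemma regret_le:
  assumes mu: "\<And>i. i \<in> {1..k} \<Longrightarrow> mu i \<in> {0..1}"
    and Mx: "Mx = Max (mu ` {1..k})"
  shows "real T * Mx - (\<Sum>t\<in>{1..T}. \<integral>w. mu (ucb_action k (table w) t) \<partial>PiM Arms M)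
    \<le> (\<Sum>i\<in>{1..k}. 1 + (if Mx - mu i \<le> \<delta> then real T * (Mx - mu i)
                           else (52 + 32 * ln (f_ucb T)) / (Mx - mu i)))"
proof -
  let ?E = "\<lambda>f :: _ \<Rightarrow> real. \<integral>w. f w \<partial>PiM Arms M"
  let ?a = "\<lambda>w t. ucb_action k (table w) t"
  define C where "C = 52 + 32 * ln (f_ucb T)"
  have C: "0 \<le> C" by (simp add: C_def f_ucb_ge_1)
  have Mx_in: "Mx \<in> mu ` {1..k}"
    unfolding Mx using k_pos by (intro Max_in) auto
  then obtain b where b: "b \<in> {1..k}" "mu b = Mx" by auto
  have le_Mx: "mu i \<le> Mx" if "i \<in> {1..k}" for i
    unfolding Mx using that by auto
  have int: "integrable (PiM Arms M) (\<lambda>w. of_bool (?a w t = i) :: real)" for t i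
  proof (rule P.integrable_const_bound[where B = 1])
    show "(\<lambda>w. of_bool (?a w t = i) :: real) \<in> borel_measurable (PiM Arms M)"
      by (rule measurable_pull_indicator)
  qed auto
  define p where "p t i = ?E (\<lambda>w. of_bool (?a w t = i))" for t i
  \<comment> \<open>Stated for arbitrary \<open>\<phi>\<close>: with \<open>mu\<close> it expands
    the expected reward, with the constant 1 it shows that the pull probabilities sum to 1.\<close>
  have decomp: "\<phi> (?a w t) = (\<Sum>i\<in>{1..k}. \<phi> i * of_bool (?a w t = i))"
    if "1 \<le> t" for \<phi> :: "nat \<Rightarrow> real" and w t
    using ucb_action_range[OF k_pos that, of "table w"] by (simp add: of_bool_def if_distrib cong: if_cong)
  have E_mu: "?E (\<lambda>w. mu (?a w t)) = (\<Sum>i\<in>{1..k}. mu i * p t i)" if "1 \<le> t" for t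
    unfolding decomp[OF that, of mu] p_def
    by (subst Bochner_Integration.integral_sum) (auto intro: int)
  have sum_p: "(\<Sum>i\<in>{1..k}. p t i) = 1" if "1 \<le> t" for t
  proof -
    have "(\<Sum>i\<in>{1..k}. p t i) = ?E (\<lambda>w. \<Sum>i\<in>{1..k}. of_bool (?a w t = i))"
      unfolding p_def by (subst Bochner_Integration.integral_sum) (auto intro: int)
    also have "\<dots> = ?E (\<lambda>w. 1)"
      using decomp[OF that, of "\<lambda>_. 1"] by simp
    finally show ?thesis using P.prob_space by (simp)
  qed
  have p_bounds: "0 \<le> p t i" "p t i \<le> 1" for t i
  proof -
    show "0 \<le> p t i" unfolding p_def by (rule Bochner_Integration.integral_nonneg) simp
    have "p t i \<le> ?E (\<lambda>_. 1)" unfolding p_def by (intro integral_mono int) auto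
    thus "p t i \<le> 1" using P.prob_space by (simp)
  qed
  have sum_p_T: "(\<Sum>t\<in>{1..T}. p t i) \<le> T" for i
    using sum_bounded_above[of "{1..T}" "\<lambda>t. p t i" 1] p_bounds by simp
  have "real T * Mx - (\<Sum>t\<in>{1..T}. ?E (\<lambda>w. mu (?a w t)))
      = (\<Sum>t\<in>{1..T}. Mx * (\<Sum>i\<in>{1..k}. p t i) - (\<Sum>i\<in>{1..k}. mu i * p t i))"
    by (simp add: E_mu sum_p sum_subtractf)
  also have "\<dots> = (\<Sum>t\<in>{1..T}. \<Sum>i\<in>{1..k}. (Mx - mu i) * p t i)"
    by (simp add: sum_distrib_left sum_subtractf left_diff_distrib)
  also have "\<dots> = (\<Sum>i\<in>{1..k}. (Mx - mu i) * (\<Sum>t\<in>{1..T}. p t i))"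
    by (subst sum.swap) (simp add: sum_distrib_left)
  also have "\<dots> \<le> (\<Sum>i\<in>{1..k}. 1 + (if Mx - mu i \<le> \<delta> then real T * (Mx - mu i) else C / (Mx - mu i)))"
  proof (rule sum_mono)
    fix i assume i: "i \<in> {1..k}"
    define D where "D = Mx - mu i"
    have D: "0 \<le> D" "D \<le> 1"
      using le_Mx[OF i] mu[OF i] mu[OF b(1)] b(2) by (auto simp: D_def)
    have "D * (\<Sum>t\<in>{1..T}. p t i) \<le> 1 + C / D" if "D \<noteq> 0"
    proof -
      have "(\<Sum>t\<in>{1..T}. p t i) = ?E (\<lambda>w. \<Sum>t\<in>{1..T}. of_bool (?a w t = i))"
        unfolding p_def by (subst Bochner_Integration.integral_sum) (auto intro: int)
      also have "\<dots> \<le> 1 + C / D\<^sup>2"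
        using expected_pulls_le[OF i b(1)] that D unfolding C_def D_def b(2) by auto
      finally have "D * (\<Sum>t\<in>{1..T}. p t i) \<le> D * (1 + C / D\<^sup>2)"
        using D by (intro mult_left_mono)
      also have "\<dots> = D + C / D"
        using that by (simp add: field_simps power2_eq_square)
      finally show ?thesis using D by simp
    qed
    moreover have "D * (\<Sum>t\<in>{1..T}. p t i) \<le> T * D"
      using mult_left_mono[OF sum_p_T D(1), of i] by (simp add: mult.commute)
    \<comment> \<open>A gap of 0 meets the second branch when \<open>\<delta>\<close> is negative;
      there \<open>C / 0 = 0\<close>, and the left side vanishes as well.\<close>
    ultimately show "(Mx - mu i) * (\<Sum>t\<in>{1..T}. p t i)
        \<le> 1 + (if Mx - mu i \<le> \<delta> then real T * (Mx - mu i) else C / (Mx - mu i))"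
      unfolding D_def[symmetric] by (cases "D = 0") auto
  qed
  finally show ?thesis unfolding C_def .
qed

end

lemma ucb_regret_le:
  fixes P :: "real \<Rightarrow> real measure" and mu :: "nat \<Rightarrow> real"
  assumes "1 \<le> k"
    and P_kernel: "P \<in> restrict_space borel {0..1} \<rightarrow>\<^sub>M subprob_algebra borel"
    and P_prob: "\<And>m. m \<in> {0..1} \<Longrightarrow> prob_space (P m)"
    and P_subg: "\<And>m s. m \<in> {0..1} \<Longrightarrow>
        integrable (P m) (\<lambda>z. exp (s * (z - m))) \<and>
        (\<integral>z. exp (s * (z - m)) \<partial>P m) \<le> exp (s\<^sup>2 / 2)"
    and mu: "\<And>i. i \<in> {1..k} \<Longrightarrow> mu i \<in> {0..1}"
    and Mx: "Mx = Max (mu ` {1..k})"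
  shows "ucb_regret P k T mu
    \<le> (\<Sum>i\<in>{1..k}. 1 + (if Mx - mu i \<le> \<delta> then real T * (Mx - mu i)
                           else (52 + 32 * ln (f_ucb T)) / (Mx - mu i)))"
proof -
  \<comment> \<open>The product needs a probability law at every index. For arms outside
    \<open>{1..k}\<close> the value \<open>mu i\<close> may leave \<open>[0,1]\<close>, where
    \<open>P\<close> is unconstrained, so a point mass serves as filler.\<close>
  define M where "M p = (if fst p \<in> {1..k} then P (mu (fst p)) else return borel 0)" for p :: "nat \<times> nat"
  have sets_M: "sets (M p) = sets borel" for p
    using sets_kernel[OF P_kernel] mu by (auto simp: M_def space_restrict_space)
  have prob_M: "prob_space (M p)" for p
    using P_prob mu by (auto simp: M_def intro!: prob_space_return)
  interpret bandit_rewards M k T mu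
  proof (intro bandit_rewards.intro bandit_rewards_axioms.intro product_prob_spaceI prob_M sets_M assms(1))
    fix i t :: nat and l :: real assume i: "i \<in> {1..k}"
    have "(\<integral>\<^sup>+z. ennreal (exp (l * (z - mu i))) \<partial>M (i, t))
        = ennreal (\<integral>z. exp (l * (z - mu i)) \<partial>P (mu i))"
      using i P_subg[OF mu[OF i]] by (auto simp: M_def intro!: nn_integral_eq_integral)
    also have "\<dots> \<le> ennreal (exp (l\<^sup>2 / 2))"
      using P_subg[OF mu[OF i]] by (intro ennreal_leI) auto
    finally show "(\<integral>\<^sup>+z. ennreal (exp (l * (z - mu i))) \<partial>M (i, t)) \<le> ennreal (exp (l\<^sup>2 / 2))" .
  qed
  have "reward_space P k T mu = PiM Arms M"
    unfolding reward_space_def by (intro PiM_cong) (auto simp: M_def)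
  thus ?thesis
    using regret_le[OF mu Mx, of \<delta>] unfolding ucb_regret_def Mx by simp
qed

subsection \<open>Averaging over the prior\<close>

text \<open>With the cut at \<open>1 / sqrt T\<close>, the linear branch has integral 1 / 2 between
  0 and the cut, and \<open>C / d\<close> has integral \<open>C / 2 * ln T\<close> between the cut
  and 1.\<close>

definition gap_bound :: "real \<Rightarrow> real \<Rightarrow> real \<Rightarrow> real" where
  "gap_bound T C d = (if d \<le> 1 / sqrt T then T * d else C / d)"

lemma gap_bound_nonneg: "0 \<le> T \<Longrightarrow> 0 \<le> C \<Longrightarrow> 0 \<le> d \<Longrightarrow> 0 \<le> gap_bound T C d"
  by (simp add: gap_bound_def)

lemma measurable_gap_bound [measurable]: "gap_bound T C \<in> borel_measurable borel"
  unfolding gap_bound_def by measurable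

text \<open>\<open>M\<close> stands for the largest of the other means and \<open>y\<close> for the
  mean of the arm itself. The gap is \<open>M - y\<close> below \<open>M\<close> and 0 above;
  bounding the density by \<open>D0\<close> leaves two elementary integrals.\<close>

lemma nn_integral_gap_bound_le:
  fixes g :: "real \<Rightarrow> real" and M T C D0 :: real
  assumes g_meas: "g \<in> borel_measurable (restrict_space borel {0..1})"
    and g_bound: "\<And>x. x \<in> {0..1} \<Longrightarrow> g x \<le> D0"
    and D0: "0 \<le> D0" and T: "1 \<le> T" and C: "0 \<le> C" and M: "M \<in> {0..1}"
  shows "(\<integral>\<^sup>+y. ennreal (gap_bound T C (max M y - y))
            \<partial>density (restrict_space lborel {0..1}) (\<lambda>x. ennreal (g x)))
     \<le> ennreal (D0 * (1 / 2 + C / 2 * ln T))"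
proof -
  define \<delta> where "\<delta> = 1 / sqrt T"
  have \<delta>: "0 < \<delta>" "\<delta> \<le> 1" "T * \<delta>\<^sup>2 = 1"
    using T by (auto simp: \<delta>_def power_divide)
  have ln_\<delta>: "- ln \<delta> = ln T / 2"
    using T by (simp add: \<delta>_def ln_div ln_sqrt)
  have [measurable]: "g \<in> borel_measurable (restrict_space lborel {0..1})"
    using g_meas by (simp cong: measurable_cong_sets add: sets_restrict_space)
  have [measurable]: "(\<lambda>y. ennreal (gap_bound T C (max M y - y))) \<in> borel_measurable (restrict_space lborel {0..1})"
    by (rule measurable_restrict_space1) measurable
  have "(\<integral>\<^sup>+y. ennreal (gap_bound T C (max M y - y))
            \<partial>density (restrict_space lborel {0..1}) (\<lambda>x. ennreal (g x)))
      = (\<integral>\<^sup>+y. ennreal (g y) * ennreal (gap_bound T C (max M y - y)) \<partial>restrict_space lborel {0..1})"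
    by (rule nn_integral_density) measurable
  also have "\<dots> = (\<integral>\<^sup>+y. ennreal (g y) * ennreal (gap_bound T C (max M y - y)) * indicator {0..1} y \<partial>lborel)"
    by (rule nn_integral_restrict_space) simp
  \<comment> \<open>Since \<open>M <= 1\<close>, the points \<open>y\<close> in \<open>[0,M]\<close>
    lie in \<open>[M - 1,M]\<close>. Extending the range below 0 only enlarges the integral and
    makes its value independent of \<open>M\<close>.\<close>
  also have "\<dots> \<le> (\<integral>\<^sup>+y. ennreal D0 * (ennreal (T * (M - y)) * indicator {M - \<delta>..M} y
      + ennreal (C / (M - y)) * indicator {M - 1..M - \<delta>} y) \<partial>lborel)"
  proof (rule nn_integral_mono)
    fix y
    show "ennreal (g y) * ennreal (gap_bound T C (max M y - y)) * indicator {0..1} y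
        \<le> ennreal D0 * (ennreal (T * (M - y)) * indicator {M - \<delta>..M} y
          + ennreal (C / (M - y)) * indicator {M - 1..M - \<delta>} y)"
    proof (cases "y \<in> {0..1}")
      case True
      have "ennreal (gap_bound T C (max M y - y)) \<le> ennreal (T * (M - y)) * indicator {M - \<delta>..M} y
          + ennreal (C / (M - y)) * indicator {M - 1..M - \<delta>} y"
        using True M \<delta> unfolding gap_bound_def \<delta>_def[symmetric]
        by (auto simp: indicator_def max_def)
      thus ?thesis
        using True g_bound[OF True] by (auto intro!: mult_mono ennreal_leI)
    qed simp
  qed
  also have "\<dots> = ennreal D0 * ((\<integral>\<^sup>+y. ennreal (T * (M - y)) * indicator {M - \<delta>..M} y \<partial>lborel)
      + (\<integral>\<^sup>+y. ennreal (C / (M - y)) * indicator {M - 1..M - \<delta>} y \<partial>lborel))"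
    by (subst nn_integral_cmult, measurable) (subst nn_integral_add, measurable)
  also have "(\<integral>\<^sup>+y. ennreal (T * (M - y)) * indicator {M - \<delta>..M} y \<partial>lborel)
      = ennreal (- (T * (M - M)\<^sup>2 / 2) - (- (T * (M - (M - \<delta>))\<^sup>2 / 2)))"
    using \<delta> T by (intro nn_integral_FTC_Icc) (auto intro!: derivative_eq_intros simp: field_simps)
  also have "(\<integral>\<^sup>+y. ennreal (C / (M - y)) * indicator {M - 1..M - \<delta>} y \<partial>lborel)
      = ennreal (- (C * ln (M - (M - \<delta>))) - (- (C * ln (M - (M - 1)))))"
    using \<delta> C by (intro nn_integral_FTC_Icc) (auto intro!: derivative_eq_intros)
  also have "ennreal D0 * (ennreal (- (T * (M - M)\<^sup>2 / 2) - (- (T * (M - (M - \<delta>))\<^sup>2 / 2)))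
      + ennreal (- (C * ln (M - (M - \<delta>))) - (- (C * ln (M - (M - 1))))))
      = ennreal (D0 * (1 / 2 + C / 2 * ln T))"
  proof -
    have "- (C * ln (M - (M - \<delta>))) - (- (C * ln (M - (M - 1)))) = C / 2 * ln T"
    proof -
      have "- (C * ln (M - (M - \<delta>))) - (- (C * ln (M - (M - 1)))) = C * (- ln \<delta>)" by simp
      thus ?thesis unfolding ln_\<delta> by simp
    qed
    moreover have "- (T * (M - M)\<^sup>2 / 2) - (- (T * (M - (M - \<delta>))\<^sup>2 / 2)) = 1 / 2"
      using \<delta>(3) by simp
    moreover have "0 \<le> C / 2 * ln T" using C T by simp
    ultimately show ?thesis
      using D0 by (simp only: flip: ennreal_plus ennreal_mult')
  qed
  finally show ?thesis .
qed

text \<open>The inserted 0 gives \<open>Max\<close> a value when \<open>i\<close> is the only arm;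
  as the entries are nonnegative, it does not change the maximum otherwise.\<close>

lemma Max_fun_upd_image:
  fixes x :: "nat \<Rightarrow> real"
  assumes "finite I" "i \<in> I" "0 \<le> y" "\<And>j. j \<in> I - {i} \<Longrightarrow> 0 \<le> x j"
  shows "Max (x(i := y) ` I) = max (Max (insert 0 (x ` (I - {i})))) y"
proof -
  have eq: "x(i := y) ` I = insert y (x ` (I - {i}))"
    using assms(2) by auto
  show ?thesis
  proof (cases "I - {i} = {}")
    case False
    then obtain j where "j \<in> I - {i}" by blast
    hence "0 \<le> Max (x ` (I - {i}))"
      using assms by (intro Max_ge_iff[THEN iffD2]) auto
    thus ?thesis
      unfolding eq using assms False by (simp add: max.commute max_def)
  next
    case True
    show ?thesis unfolding eq True using assms(3) by simp
  qed
qed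

theorem theorem2:
  fixes P :: "real \<Rightarrow> real measure" and g :: "real \<Rightarrow> real"
    and k T :: nat and D0 :: real
  assumes "k \<ge> 1" and "T \<ge> 1"
    and P_kernel: "P \<in> restrict_space borel {0..1} \<rightarrow>\<^sub>M subprob_algebra borel"
    and P_prob: "\<And>m. m \<in> {0..1} \<Longrightarrow> prob_space (P m)"
    and P_mean: "\<And>m. m \<in> {0..1} \<Longrightarrow> integrable (P m) (\<lambda>z. z) \<and> (\<integral>z. z \<partial>P m) = m"
    and P_subg: "\<And>m s. m \<in> {0..1} \<Longrightarrow>
        integrable (P m) (\<lambda>z. exp (s * (z - m))) \<and>
        (\<integral>z. exp (s * (z - m)) \<partial>P m) \<le> exp (s^2 / 2)"
    and g_meas: "g \<in> borel_measurable (restrict_space borel {0..1})"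
    and g_nonneg: "\<And>x. x \<in> {0..1} \<Longrightarrow> 0 \<le> g x"
    and g_prob: "prob_space (density (restrict_space lborel {0..1}) (\<lambda>x. ennreal (g x)))"
    and g_bound: "\<And>x. x \<in> {0..1} \<Longrightarrow> g x \<le> D0"
  shows "ucb_bayes_regret P (density (restrict_space lborel {0..1}) (\<lambda>x. ennreal (g x))) k T
         \<le> real k * (1 + D0 + D0 * (10 + 18 * ln (f_ucb (real T))) * (2 + 2 * ln (real k) + ln (real T)))"
proof -
  define Pr where "Pr = density (restrict_space lborel {0..1}) (\<lambda>x. ennreal (g x))"
  interpret Pr: prob_space Pr using g_prob by (simp add: Pr_def)
  interpret product_prob_space "\<lambda>_. Pr" "{1..k}" ..
  let ?Q = "PiM {1..k} (\<lambda>_. Pr)"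
  define L where "L = ln (f_ucb (real T))"
  define C where "C = 52 + 32 * L"
  define B where "B = D0 * (1 / 2 + C / 2 * ln (real T))"
  define q where "q mu i = gap_bound T C (Max (mu ` {1..k}) - mu i)" for mu :: "nat \<Rightarrow> real" and i
  have L: "0 \<le> L" by (simp add: L_def f_ucb_ge_1)
  hence C: "0 \<le> C" by (simp add: C_def)
  have D0: "0 \<le> D0" using g_nonneg[of 0] g_bound[of 0] by simp
  have B: "0 \<le> B" using D0 C assms(2) by (simp add: B_def)
  have space_Pr: "space Pr = {0..1}"
    by (simp add: Pr_def space_restrict_space)
  have id_Pr: "(\<lambda>y. y) \<in> borel_measurable Pr"
    unfolding Pr_def measurable_density_eq1 by (rule measurable_restrict_space1) simp
  have comp: "(\<lambda>mu. mu i) \<in> borel_measurable ?Q" if "i \<in> {1..k}" for i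
    by (rule measurable_compose[OF measurable_component_singleton[OF that] id_Pr])
  have q_meas: "(\<lambda>mu. q mu i) \<in> borel_measurable ?Q" if "i \<in> {1..k}" for i
    unfolding q_def
    by (intro measurable_compose[OF _ measurable_gap_bound] borel_measurable_diff comp that
        borel_measurable_Max) auto
  have mu_range: "mu i \<in> {0..1}" if "mu \<in> space ?Q" "i \<in> {1..k}" for mu i
    using that by (auto simp: space_PiM space_Pr PiE_iff)
  have q_nonneg: "0 \<le> q mu i" if "i \<in> {1..k}" for mu i
    unfolding q_def using that C by (intro gap_bound_nonneg) auto
  have q_int: "(\<integral>\<^sup>+mu. ennreal (q mu i) \<partial>?Q) \<le> ennreal B" if i: "i \<in> {1..k}" for i
  proof -
    define J where "J = {1..k} - {i}"
    have J: "finite J" "i \<notin> J" "{1..k} = insert i J"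
      using i by (auto simp: J_def)
    interpret J: product_prob_space "\<lambda>_. Pr" J ..
    \<comment> \<open>The mean of arm \<open>i\<close> is integrated first, with the other means
      held fixed, so that their maximum \<open>M\<close> is a constant in the gap integral.\<close>
    have "(\<integral>\<^sup>+mu. ennreal (q mu i) \<partial>?Q) = (\<integral>\<^sup>+x. (\<integral>\<^sup>+y. ennreal (q (x(i := y)) i) \<partial>Pr) \<partial>PiM J (\<lambda>_. Pr))"
      unfolding J(3) by (rule product_nn_integral_insert[OF J(1,2)])
        (use q_meas[OF i] in \<open>simp add: J(3)[symmetric]\<close>)
    also have "\<dots> \<le> (\<integral>\<^sup>+x. ennreal B \<partial>PiM J (\<lambda>_. Pr))"
    proof (rule nn_integral_mono)
      fix x assume "x \<in> space (PiM J (\<lambda>_. Pr))"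
      hence x: "x j \<in> {0..1}" if "j \<in> J" for j
        using that by (auto simp: space_PiM space_Pr PiE_iff)
      define M where "M = Max (insert 0 (x ` J))"
      have "M \<in> insert 0 (x ` J)"
        unfolding M_def using J by (intro Max_in) auto
      hence M: "M \<in> {0..1}" using x by auto
      have "(\<integral>\<^sup>+y. ennreal (q (x(i := y)) i) \<partial>Pr) = (\<integral>\<^sup>+y. ennreal (gap_bound T C (max M y - y)) \<partial>Pr)"
      proof (rule nn_integral_cong)
        fix y assume "y \<in> space Pr"
        hence "Max (x(i := y) ` {1..k}) = max M y"
          unfolding M_def J_def using i x by (intro Max_fun_upd_image) (auto simp: space_Pr J_def)
        thus "ennreal (q (x(i := y)) i) = ennreal (gap_bound T C (max M y - y))"
          by (simp add: q_def)
      qed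
      also have "\<dots> \<le> ennreal B"
        unfolding Pr_def B_def using assms(2) C M D0
        by (intro nn_integral_gap_bound_le g_meas g_bound) auto
      finally show "(\<integral>\<^sup>+y. ennreal (q (x(i := y)) i) \<partial>Pr) \<le> ennreal B" .
    qed
    also have "\<dots> = ennreal B"
      using J.P.emeasure_space_1 by simp
    finally show ?thesis .
  qed
  have q_integrable: "integrable ?Q (\<lambda>mu. q mu i)" if "i \<in> {1..k}" for i
    using q_int[OF that] q_meas[OF that] q_nonneg[OF that]
    by (intro integrableI_nonneg) (auto intro: le_less_trans)
  have q_integral: "(\<integral>mu. q mu i \<partial>?Q) \<le> B" if "i \<in> {1..k}" for i
    using q_int[OF that] q_integrable[OF that] q_nonneg[OF that] B
    by (subst (asm) nn_integral_eq_integral) (auto simp: ennreal_le_iff)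
  have "ucb_bayes_regret P Pr k T = (\<integral>mu. ucb_regret P k T mu \<partial>?Q)"
    by (simp add: ucb_bayes_regret_def)
  also have "\<dots> \<le> (\<integral>mu. (\<Sum>i\<in>{1..k}. 1 + q mu i) \<partial>?Q)"
    \<comment> \<open>The regret need not be measurable in \<open>mu\<close>: if it is not integrable, its integral is \<open>0\<close>.\<close>
  proof (rule integral_mono')
    show "integrable ?Q (\<lambda>mu. \<Sum>i\<in>{1..k}. 1 + q mu i)"
      by (intro Bochner_Integration.integrable_sum Bochner_Integration.integrable_add
          P.integrable_const q_integrable)
    show "0 \<le> (\<Sum>i\<in>{1..k}. 1 + q mu i)" for mu
      by (intro sum_nonneg add_nonneg_nonneg q_nonneg) auto
    show "ucb_regret P k T mu \<le> (\<Sum>i\<in>{1..k}. 1 + q mu i)" if "mu \<in> space ?Q" for mu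
      unfolding q_def gap_bound_def C_def L_def
      by (intro ucb_regret_le P_kernel P_prob P_subg mu_range[OF that] assms(1) refl)
  qed
  also have "\<dots> = (\<Sum>i\<in>{1..k}. 1 + (\<integral>mu. q mu i \<partial>?Q))"
  proof -
    have "(\<integral>mu. 1 + q mu i \<partial>?Q) = 1 + (\<integral>mu. q mu i \<partial>?Q)" if "i \<in> {1..k}" for i
      using P.prob_space
      by (subst Bochner_Integration.integral_add[OF P.integrable_const q_integrable[OF that]])
         (simp del: One_nat_def)
    thus ?thesis
      by (subst Bochner_Integration.integral_sum)
         (auto intro!: Bochner_Integration.integrable_add P.integrable_const q_integrable
           simp del: One_nat_def)
  qed
  also have "\<dots> \<le> (\<Sum>i\<in>{1..k}. 1 + B)"
    by (intro sum_mono add_left_mono q_integral)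
  also have "\<dots> = real k * (1 + B)" by simp
  also have "\<dots> \<le> real k * (1 + D0 + D0 * (10 + 18 * L) * (2 + 2 * ln (real k) + ln (real T)))"
  proof -
    define x where "x = ln (real T)"
    have x: "0 \<le> x" using assms(2) by (simp add: x_def)
    \<comment> \<open>After expansion, \<open>20 + 36 * L\<close> has to pay for the excess
      \<open>26 * x - 10 * x\<close>. For \<open>x <= 1\<close> the constant suffices; otherwise
      \<open>T <= T * (ln T)^2 <= f_ucb T\<close>, hence \<open>x <= L\<close>.\<close>
    have "16 * x \<le> 20 + 36 * L"
    proof (cases "x \<le> 1")
      case False
      have "1 \<le> x\<^sup>2" using False by simp
      hence "real T * 1 \<le> real T * x\<^sup>2" by (intro mult_left_mono) auto
      hence "real T \<le> f_ucb (real T)" by (simp add: f_ucb_def x_def)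
      hence "x \<le> L" using assms(2) unfolding x_def L_def by (intro ln_mono) auto
      thus ?thesis using x by linarith
    qed (use L in linarith)
    moreover have "0 \<le> L * x" using L x by simp
    moreover have "1 / 2 + C / 2 * x = 1 / 2 + 26 * x + 16 * (L * x)"
      by (simp add: C_def field_simps)
    moreover have "1 + (10 + 18 * L) * (2 + x) = 21 + 36 * L + 10 * x + 18 * (L * x)"
      by (simp add: algebra_simps)
    ultimately have "1 / 2 + C / 2 * x \<le> 1 + (10 + 18 * L) * (2 + x)"
      by linarith
    also have "\<dots> \<le> 1 + (10 + 18 * L) * (2 + 2 * ln (real k) + x)"
      using L assms(1) by (intro add_left_mono mult_left_mono) auto
    finally have "B \<le> D0 * (1 + (10 + 18 * L) * (2 + 2 * ln (real k) + x))"
      unfolding B_def x_def[symmetric] using D0 by (intro mult_left_mono)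
    thus ?thesis unfolding x_def by (intro mult_left_mono) (auto simp: algebra_simps)
  qed
  finally show ?thesis unfolding Pr_def L_def .
qed

end
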